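(* For all names $P,Q$ with $\eta\,P\,\mathrm{balls}$ and $\eta\,Q\,\mathrm{balls}$: if $\mathrm{same\_center}(P,Q)$ does not hold, then there exist names $u,v$ such that $\mathrm{GPointOpen}(u)$, $\mathrm{GPointOpen}(v)$, $\eta\,P\,u$, $\eta\,Q\,v$, and $\mathrm{PointSet\_meet}(u,v)$ does not hold.
   Context: Logic is classical. Names form a type $N$; a name may designate zero, one or several objects. The relation $\eta : N\to N\to \mathrm{Prop}$ (singular inclusion) is governed by Leśniewski's Ontology: $\eta\,A\,b$ holds iff [there is $C$ with $\eta\,C\,A$] and [for all $C,D$, $\eta\,C\,A$ and $\eta\,D\,A$ imply $\eta\,C\,D$] and [for all $C$, $\eta\,C\,A$ implies $\eta\,C\,b$]; i.e. $A$ designates exactly one object, which is among those designated by $b$. $A$ is an Individual iff $\eta\,A\,A$. Notation: $P\equiv Q$ iff $\eta\,P\,Q$ and $\eta\,Q\,P$; $a\approx b$ iff $\forall P,\ \eta\,P\,a\leftrightarrow\eta\,P\,b$. Names with the same extension are interchangeable. Name-forming operators are introduced by stating when $\eta\,P\,(\cdot)$ holds. Mereology: $\eta\,P\,(\mathrm{pt}(Q))$ ("$P$ is a part of $Q$") relates individuals and is reflexive on individuals, transitive, and antisymmetric up to $\equiv$; a proper part of $Q$ is a part $P$ with not $P\equiv Q$; $\eta\,P\,(\mathrm{ext}(Q))$ ("$P$ is external to $Q$") means $P,Q$ are individuals with no common part. Geometry: $\mathrm{balls}$ is a primitive name whose members are individuals (balls); at least one ball exists. $\eta\,P\,(\mathrm{Concent}(Q))$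 means that the balls $P,Q$ are concentric in Tarski's sense: $P\equiv Q$; or $P$ is a proper part of $Q$ and any two balls $X,Y$ externally diametrical to $P$ and internally tangent to $Q$ are internally diametrical to $Q$; or the same with $P,Q$ exchanged. Here (all variables balls): $A$ is externally tangent to $B$ if $A$ is external to $B$ and of any two balls $X,Y$ having $A$ as part and external to $B$ one is part of the other; $A$ is internally tangent to $B$ if $A$ is a proper part of $B$ and of any two balls $X,Y$ having $A$ as part and being parts of $B$ one is part of the other; $A,B$ are externally diametrical to $C$ if both are externally tangent to $C$ and whenever $X,Y$ are external to $C$, $A$ is part of $X$ and $B$ is part of $Y$, then $X$ is external to $Y$; $A,B$ are internally diametrical to $C$ if both are internally tangent to $C$ and whenever $X,Y$ are external to $C$, $A$ is externally tangent to $X$ and $B$ to $Y$, then $X$ is external to $Y$. $\eta\,P\,(\mathrm{Point}(Q))$ iff $\eta\,P\,\mathrm{balls}$, $\eta\,Q\,\mathrm{balls}$ and $\eta\,P\,(\mathrm{Concent}(Q))$. Standing assumptions: concentricity is an equivalence relation on balls, and concentric balls $P,Q$ satisfy $\mathrm{Point}(P)\approx\mathrm{Point}(Q)$. Betweenness: $\eta\,A\,(\mathrm{btw}(B,C))$ iff $A,B,C$ are balls and there are $D,E,F$ with $\eta\,D\,(\mathrm{Point}(B))$, $\eta\,E\,(\mathrm{Point}(A))$, $\eta\,F\,(\mathrm{Point}(C))$ and $\eta\,D\,(\mathrm{ED}(E,F))$, where $\eta\,D\,(\mathrm{ED}(E,F))$ means that the balls $D$ and $F$ are externally diametrical to the ball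 $E$. Standing axiom ($\mathrm{Three\_points}$): for any two balls $P,Q$ that are not concentric there is $R$ with $\eta\,R\,(\mathrm{btw}(P,Q))$. Point-class notions: $\mathrm{same\_center}(P,Q)$ iff $\mathrm{Point}(P)\approx\mathrm{Point}(Q)$. $\mathrm{PointSet\_incl}(u,v)$ iff for all $B$ with $\eta\,B\,\mathrm{balls}$, $\eta\,B\,u$ implies $\eta\,B\,v$. $\mathrm{PointSet\_stable}(u)$ iff for all $B,C$, $\mathrm{same\_center}(B,C)$ and $\eta\,B\,u$ imply $\eta\,C\,u$. $\mathrm{PointSet\_meet}(u,v)$ iff there are $B,C$ with $\eta\,B\,\mathrm{balls}$, $\eta\,C\,\mathrm{balls}$, $\mathrm{same\_center}(B,C)$, $\eta\,B\,u$ and $\eta\,C\,v$. $\eta\,P\,\mathrm{GBasicPointSet}(Q)$ iff $\eta\,Q\,\mathrm{balls}$, $\eta\,P\,\mathrm{balls}$ and there is $C$ with $\eta\,C\,\mathrm{balls}$, $\mathrm{same\_center}(P,C)$ and $\eta\,C\,(\mathrm{pt}(Q))$. $\mathrm{GPointOpen}(u)$ iff $\mathrm{PointSet\_stable}(u)$; and every $P$ with $\eta\,P\,u$ satisfies $\eta\,P\,\mathrm{balls}$; and for every $P$ with $\eta\,P\,u$ there is $Q$ with $\eta\,Q\,\mathrm{balls}$, $\eta\,P\,\mathrm{GBasicPointSet}(Q)$ and $\mathrm{PointSet\_incl}(\mathrm{GBasicPointSet}(Q),u)$. *)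

theory Defs
  imports Main
begin

locale ontology =
  fixes \<eta> :: "'n \<Rightarrow> 'n \<Rightarrow> bool"
  assumes ontology_axiom:
    "\<eta> A b \<longleftrightarrow> (\<exists>C. \<eta> C A) \<and> (\<forall>C D. \<eta> C A \<and> \<eta> D A \<longrightarrow> \<eta> C D) \<and> (\<forall>C. \<eta> C A \<longrightarrow> \<eta> C b)"
    \<comment> \<open>Interchangeability in every context is Leibniz equality, that is, equality in HOL.\<close>
    and extensionality: "(\<forall>P. \<eta> P a \<longleftrightarrow> \<eta> P b) \<Longrightarrow> a = b"

definition individual :: "('n \<Rightarrow> 'n \<Rightarrow> bool) \<Rightarrow> 'n \<Rightarrow> bool" where
  "individual \<eta> A \<longleftrightarrow> \<eta> A A"

definition sing_eq :: "('n \<Rightarrow> 'n \<Rightarrow> bool) \<Rightarrow> 'n \<Rightarrow> 'n \<Rightarrow> bool" where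
  "sing_eq \<eta> P Q \<longleftrightarrow> \<eta> P Q \<and> \<eta> Q P"

definition ext_eq :: "('n \<Rightarrow> 'n \<Rightarrow> bool) \<Rightarrow> 'n \<Rightarrow> 'n \<Rightarrow> bool" where
  "ext_eq \<eta> a b \<longleftrightarrow> (\<forall>P. \<eta> P a \<longleftrightarrow> \<eta> P b)"

text \<open>
  A name-forming operator is a function on names that is introduced by saying when \<open>\<eta> P\<close>
  holds of its value. Here and below such operators are locale parameters, and their
  introduction rules are locale assumptions; by extensionality each rule determines its
  operator uniquely. Only \<open>pt\<close> and \<open>balls\<close> are primitive. No comprehension principle for
  names is assumed.
\<close>

locale mereology = ontology \<eta>
  for \<eta> :: "'n \<Rightarrow> 'n \<Rightarrow> bool" +
  fixes pt :: "'n \<Rightarrow> 'n"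
    and ext :: "'n \<Rightarrow> 'n"
  assumes pt_individuals: "\<eta> P (pt Q) \<Longrightarrow> individual \<eta> P \<and> individual \<eta> Q"
    and pt_refl: "individual \<eta> P \<Longrightarrow> \<eta> P (pt P)"
    and pt_trans: "\<eta> P (pt Q) \<Longrightarrow> \<eta> Q (pt R) \<Longrightarrow> \<eta> P (pt R)"
    and pt_antisym: "\<eta> P (pt Q) \<Longrightarrow> \<eta> Q (pt P) \<Longrightarrow> sing_eq \<eta> P Q"
    and ext_iff: "\<eta> P (ext Q) \<longleftrightarrow>
      individual \<eta> P \<and> individual \<eta> Q \<and> \<not> (\<exists>C. \<eta> C (pt P) \<and> \<eta> C (pt Q))"

definition proper_part :: "('n \<Rightarrow> 'n \<Rightarrow> bool) \<Rightarrow> ('n \<Rightarrow> 'n) \<Rightarrow> 'n \<Rightarrow> 'n \<Rightarrow> bool" where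
  "proper_part \<eta> pt P Q \<longleftrightarrow> \<eta> P (pt Q) \<and> \<not> sing_eq \<eta> P Q"

definition ext_tangent ::
    "('n \<Rightarrow> 'n \<Rightarrow> bool) \<Rightarrow> ('n \<Rightarrow> 'n) \<Rightarrow> ('n \<Rightarrow> 'n) \<Rightarrow> 'n \<Rightarrow> 'n \<Rightarrow> 'n \<Rightarrow> bool" where
  "ext_tangent \<eta> pt ext balls A B \<longleftrightarrow>
     \<eta> A balls \<and> \<eta> B balls \<and> \<eta> A (ext B) \<and>
     (\<forall>X Y. \<eta> X balls \<and> \<eta> Y balls \<and> \<eta> A (pt X) \<and> \<eta> A (pt Y) \<and> \<eta> X (ext B) \<and> \<eta> Y (ext B)
        \<longrightarrow> \<eta> X (pt Y) \<or> \<eta> Y (pt X))"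

definition int_tangent ::
    "('n \<Rightarrow> 'n \<Rightarrow> bool) \<Rightarrow> ('n \<Rightarrow> 'n) \<Rightarrow> 'n \<Rightarrow> 'n \<Rightarrow> 'n \<Rightarrow> bool" where
  "int_tangent \<eta> pt balls A B \<longleftrightarrow>
     \<eta> A balls \<and> \<eta> B balls \<and> proper_part \<eta> pt A B \<and>
     (\<forall>X Y. \<eta> X balls \<and> \<eta> Y balls \<and> \<eta> A (pt X) \<and> \<eta> A (pt Y) \<and> \<eta> X (pt B) \<and> \<eta> Y (pt B)
        \<longrightarrow> \<eta> X (pt Y) \<or> \<eta> Y (pt X))"

text \<open>In the next two definitions the last argument is the ball to which the other two
  are diametrical.\<close>

definition ext_diametrical ::
    "('n \<Rightarrow> 'n \<Rightarrow> bool) \<Rightarrow> ('n \<Rightarrow> 'n) \<Rightarrow> ('n \<Rightarrow> 'n) \<Rightarrow> 'n \<Rightarrow> 'n \<Rightarrow> 'n \<Rightarrow> 'n \<Rightarrow> bool" where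
  "ext_diametrical \<eta> pt ext balls A B C \<longleftrightarrow>
     ext_tangent \<eta> pt ext balls A C \<and> ext_tangent \<eta> pt ext balls B C \<and>
     (\<forall>X Y. \<eta> X balls \<and> \<eta> Y balls \<and> \<eta> X (ext C) \<and> \<eta> Y (ext C) \<and> \<eta> A (pt X) \<and> \<eta> B (pt Y)
        \<longrightarrow> \<eta> X (ext Y))"

definition int_diametrical ::
    "('n \<Rightarrow> 'n \<Rightarrow> bool) \<Rightarrow> ('n \<Rightarrow> 'n) \<Rightarrow> ('n \<Rightarrow> 'n) \<Rightarrow> 'n \<Rightarrow> 'n \<Rightarrow> 'n \<Rightarrow> 'n \<Rightarrow> bool" where
  "int_diametrical \<eta> pt ext balls A B C \<longleftrightarrow>
     int_tangent \<eta> pt balls A C \<and> int_tangent \<eta> pt balls B C \<and>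
     (\<forall>X Y. \<eta> X balls \<and> \<eta> Y balls \<and> \<eta> X (ext C) \<and> \<eta> Y (ext C) \<and>
        ext_tangent \<eta> pt ext balls A X \<and> ext_tangent \<eta> pt ext balls B Y
        \<longrightarrow> \<eta> X (ext Y))"

definition inner_concentric ::
    "('n \<Rightarrow> 'n \<Rightarrow> bool) \<Rightarrow> ('n \<Rightarrow> 'n) \<Rightarrow> ('n \<Rightarrow> 'n) \<Rightarrow> 'n \<Rightarrow> 'n \<Rightarrow> 'n \<Rightarrow> bool" where
  "inner_concentric \<eta> pt ext balls P Q \<longleftrightarrow>
     proper_part \<eta> pt P Q \<and>
     (\<forall>X Y. \<eta> X balls \<and> \<eta> Y balls \<and> ext_diametrical \<eta> pt ext balls X Y P \<and>
        int_tangent \<eta> pt balls X Q \<and> int_tangent \<eta> pt balls Y Q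
        \<longrightarrow> int_diametrical \<eta> pt ext balls X Y Q)"

definition concentric ::
    "('n \<Rightarrow> 'n \<Rightarrow> bool) \<Rightarrow> ('n \<Rightarrow> 'n) \<Rightarrow> ('n \<Rightarrow> 'n) \<Rightarrow> 'n \<Rightarrow> 'n \<Rightarrow> 'n \<Rightarrow> bool" where
  "concentric \<eta> pt ext balls P Q \<longleftrightarrow>
     \<eta> P balls \<and> \<eta> Q balls \<and>
     (sing_eq \<eta> P Q \<or> inner_concentric \<eta> pt ext balls P Q \<or> inner_concentric \<eta> pt ext balls Q P)"

locale ball_geometry = mereology \<eta> pt ext
  for \<eta> :: "'n \<Rightarrow> 'n \<Rightarrow> bool" and pt :: "'n \<Rightarrow> 'n" and ext :: "'n \<Rightarrow> 'n" +
  fixes balls :: 'n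
    and Concent :: "'n \<Rightarrow> 'n"
    and Point :: "'n \<Rightarrow> 'n"
  assumes balls_individuals: "\<eta> P balls \<Longrightarrow> individual \<eta> P"
    and balls_exist: "\<exists>P. \<eta> P balls"
    and Concent_iff: "\<eta> P (Concent Q) \<longleftrightarrow> concentric \<eta> pt ext balls P Q"
    and Point_iff: "\<eta> P (Point Q) \<longleftrightarrow> \<eta> P balls \<and> \<eta> Q balls \<and> \<eta> P (Concent Q)"
    and Concent_equiv: "equiv {P. \<eta> P balls} {(P, Q). \<eta> P (Concent Q)}"
    and Concent_Point: "\<eta> P balls \<Longrightarrow> \<eta> Q balls \<Longrightarrow> \<eta> P (Concent Q) \<Longrightarrow> ext_eq \<eta> (Point P) (Point Q)"

locale between_geometry = ball_geometry \<eta> pt ext balls Concent Point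
  for \<eta> :: "'n \<Rightarrow> 'n \<Rightarrow> bool" and pt :: "'n \<Rightarrow> 'n" and ext :: "'n \<Rightarrow> 'n"
    and balls :: 'n and Concent :: "'n \<Rightarrow> 'n" and Point :: "'n \<Rightarrow> 'n" +
  fixes ED :: "'n \<Rightarrow> 'n \<Rightarrow> 'n"
    and btw :: "'n \<Rightarrow> 'n \<Rightarrow> 'n"
  assumes ED_iff: "\<eta> D (ED E F) \<longleftrightarrow> ext_diametrical \<eta> pt ext balls D F E"
    and btw_iff: "\<eta> A (btw B C) \<longleftrightarrow>
      \<eta> A balls \<and> \<eta> B balls \<and> \<eta> C balls \<and>
      (\<exists>D E F. \<eta> D (Point B) \<and> \<eta> E (Point A) \<and> \<eta> F (Point C) \<and> \<eta> D (ED E F))"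
    and Three_points:
      "\<eta> P balls \<Longrightarrow> \<eta> Q balls \<Longrightarrow> \<not> \<eta> P (Concent Q) \<Longrightarrow> \<exists>R. \<eta> R (btw P Q)"

definition same_center :: "('n \<Rightarrow> 'n \<Rightarrow> bool) \<Rightarrow> ('n \<Rightarrow> 'n) \<Rightarrow> 'n \<Rightarrow> 'n \<Rightarrow> bool" where
  "same_center \<eta> Point P Q \<longleftrightarrow> ext_eq \<eta> (Point P) (Point Q)"

definition PointSet_incl :: "('n \<Rightarrow> 'n \<Rightarrow> bool) \<Rightarrow> 'n \<Rightarrow> 'n \<Rightarrow> 'n \<Rightarrow> bool" where
  "PointSet_incl \<eta> balls u v \<longleftrightarrow> (\<forall>B. \<eta> B balls \<longrightarrow> \<eta> B u \<longrightarrow> \<eta> B v)"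

definition PointSet_stable :: "('n \<Rightarrow> 'n \<Rightarrow> bool) \<Rightarrow> ('n \<Rightarrow> 'n) \<Rightarrow> 'n \<Rightarrow> bool" where
  "PointSet_stable \<eta> Point u \<longleftrightarrow> (\<forall>B C. same_center \<eta> Point B C \<and> \<eta> B u \<longrightarrow> \<eta> C u)"

definition PointSet_meet ::
    "('n \<Rightarrow> 'n \<Rightarrow> bool) \<Rightarrow> 'n \<Rightarrow> ('n \<Rightarrow> 'n) \<Rightarrow> 'n \<Rightarrow> 'n \<Rightarrow> bool" where
  "PointSet_meet \<eta> balls Point u v \<longleftrightarrow>
     (\<exists>B C. \<eta> B balls \<and> \<eta> C balls \<and> same_center \<eta> Point B C \<and> \<eta> B u \<and> \<eta> C v)"

definition GPointOpen ::
    "('n \<Rightarrow> 'n \<Rightarrow> bool) \<Rightarrow> 'n \<Rightarrow> ('n \<Rightarrow> 'n) \<Rightarrow> ('n \<Rightarrow> 'n) \<Rightarrow> 'n \<Rightarrow> bool" where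
  "GPointOpen \<eta> balls Point GBasicPointSet u \<longleftrightarrow>
     PointSet_stable \<eta> Point u \<and>
     (\<forall>P. \<eta> P u \<longrightarrow> \<eta> P balls) \<and>
     (\<forall>P. \<eta> P u \<longrightarrow> (\<exists>Q. \<eta> Q balls \<and> \<eta> P (GBasicPointSet Q) \<and>
                           PointSet_incl \<eta> balls (GBasicPointSet Q) u))"

locale point_geometry = between_geometry \<eta> pt ext balls Concent Point ED btw
  for \<eta> :: "'n \<Rightarrow> 'n \<Rightarrow> bool" and pt :: "'n \<Rightarrow> 'n" and ext :: "'n \<Rightarrow> 'n"
    and balls :: 'n and Concent :: "'n \<Rightarrow> 'n" and Point :: "'n \<Rightarrow> 'n"
    and ED :: "'n \<Rightarrow> 'n \<Rightarrow> 'n" and btw :: "'n \<Rightarrow> 'n \<Rightarrow> 'n" +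
  fixes GBasicPointSet :: "'n \<Rightarrow> 'n"
  assumes GBasicPointSet_iff: "\<eta> P (GBasicPointSet Q) \<longleftrightarrow>
    \<eta> Q balls \<and> \<eta> P balls \<and> (\<exists>C. \<eta> C balls \<and> same_center \<eta> Point P C \<and> \<eta> C (pt Q))"

end

theory Submission
  imports Defs
begin

text \<open>
  Two disjoint balls separate two distinct centres: concentric balls are nested, so a point
  class with a member inside each of two balls external to one another would have a member
  that is a common part of both (lemma \<open>external_basic_sets_do_not_meet\<close>). Disjoint balls
  around the given centres come from betweenness: for non-concentric \<open>P\<close> and \<open>Q\<close> the
  three-points axiom yields balls \<open>D\<close> and \<open>F\<close>, concentric with \<open>P\<close> and \<open>Q\<close>, that are externally
  diametrical to a third ball, and such balls are external to each other (lemma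
  \<open>external_concentric_balls\<close>). The basic sets of \<open>D\<close> and \<open>F\<close> are then the open sets sought.
\<close>

lemma (in ontology) sing_eq_imp_eq:
  assumes "sing_eq \<eta> A B"
  shows "A = B"
proof -
  have "\<eta> A B" and "\<eta> B A"
    using assms unfolding sing_eq_def by blast+
  then have "\<forall>C. \<eta> C A \<longrightarrow> \<eta> C B" and "\<forall>C. \<eta> C B \<longrightarrow> \<eta> C A"
    using ontology_axiom[THEN iffD1] by blast+
  then show ?thesis
    using extensionality by blast
qed

context ball_geometry
begin

lemma ball_part_refl: "\<eta> P balls \<Longrightarrow> \<eta> P (pt P)"
  using balls_individuals pt_refl by blast

lemma ball_in_own_Point: "\<eta> P balls \<Longrightarrow> \<eta> P (Point P)"
  using Concent_equiv by (auto simp: Point_iff equiv_def refl_on_def)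

lemma in_Point_iff_same_center:
  assumes "\<eta> P balls"
  shows "\<eta> P (Point Q) \<longleftrightarrow> same_center \<eta> Point P Q"
proof
  assume "\<eta> P (Point Q)"
  then show "same_center \<eta> Point P Q"
    using Concent_Point Point_iff unfolding same_center_def by blast
next
  assume "same_center \<eta> Point P Q"
  then show "\<eta> P (Point Q)"
    using assms ball_in_own_Point unfolding same_center_def ext_eq_def by blast
qed

lemma same_center_nested:
  assumes "\<eta> P balls" and "same_center \<eta> Point P Q"
  shows "\<eta> P (pt Q) \<or> \<eta> Q (pt P)"
proof -
  have "concentric \<eta> pt ext balls P Q"
    using assms in_Point_iff_same_center Point_iff Concent_iff by blast
  then have "P = Q \<or> \<eta> P (pt Q) \<or> \<eta> Q (pt P)"
    by (auto simp: concentric_def inner_concentric_def proper_part_def dest: sing_eq_imp_eq)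
  then show ?thesis
    using ball_part_refl[OF assms(1)] by auto
qed

text \<open>The condition on enlargements of the two balls, applied to the balls themselves, says
  that they are disjoint.\<close>

lemma ext_diametrical_imp_external:
  assumes "ext_diametrical \<eta> pt ext balls A B C"
  shows "\<eta> A (ext B)"
proof -
  have "\<eta> A balls" "\<eta> B balls" "\<eta> A (ext C)" "\<eta> B (ext C)"
    using assms by (simp_all add: ext_diametrical_def ext_tangent_def)
  then show ?thesis
    using assms[unfolded ext_diametrical_def, THEN conjunct2, THEN conjunct2]
      ball_part_refl[of A] ball_part_refl[of B] by blast
qed

end

lemma (in between_geometry) external_concentric_balls:
  assumes "\<eta> P balls" and "\<eta> Q balls" and "\<not> same_center \<eta> Point P Q"
  obtains D F where "\<eta> D (Point P)" and "\<eta> F (Point Q)" and "\<eta> D (ext F)"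
proof -
  have "\<not> \<eta> P (Concent Q)"
    using assms in_Point_iff_same_center Point_iff by blast
  then obtain R where "\<eta> R (btw P Q)"
    using assms Three_points by blast
  then obtain D E F where "\<eta> D (Point P)" "\<eta> F (Point Q)" "\<eta> D (ED E F)"
    unfolding btw_iff by blast
  then show thesis
    using that ED_iff ext_diametrical_imp_external by blast
qed

context point_geometry
begin

lemma Point_in_basic_set:
  assumes "\<eta> P balls" and "\<eta> D (Point P)"
  shows "\<eta> P (GBasicPointSet D)"
proof -
  have "\<eta> D balls" using assms Point_iff by blast
  moreover have "same_center \<eta> Point P D"
    using assms calculation in_Point_iff_same_center by (simp add: same_center_def ext_eq_def)
  ultimately show ?thesis
    using assms ball_part_refl unfolding GBasicPointSet_iff by blast
qed

text \<open>Passing to another name with the same point class does not lead out of the balls: the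
  class of a ball is inhabited, while a name that is not a ball has an empty class.\<close>

lemma basic_set_stable: "PointSet_stable \<eta> Point (GBasicPointSet D)"
  unfolding PointSet_stable_def
proof (intro allI impI, elim conjE)
  fix B C
  assume BC: "same_center \<eta> Point B C" and B: "\<eta> B (GBasicPointSet D)"
  have "\<eta> C balls"
    using BC B in_Point_iff_same_center Point_iff GBasicPointSet_iff by blast
  moreover obtain A where "\<eta> A balls" "same_center \<eta> Point B A" "\<eta> A (pt D)" "\<eta> D balls"
    using B unfolding GBasicPointSet_iff by blast
  moreover have "same_center \<eta> Point C A"
    using BC calculation(3) by (simp add: same_center_def ext_eq_def)
  ultimately show "\<eta> C (GBasicPointSet D)"
    unfolding GBasicPointSet_iff by blast
qed

lemma basic_set_open:
  assumes "\<eta> D balls"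
  shows "GPointOpen \<eta> balls Point GBasicPointSet (GBasicPointSet D)"
  using assms basic_set_stable GBasicPointSet_iff
  unfolding GPointOpen_def PointSet_incl_def by blast

lemma external_basic_sets_do_not_meet:
  assumes "\<eta> D (ext F)"
  shows "\<not> PointSet_meet \<eta> balls Point (GBasicPointSet D) (GBasicPointSet F)"
proof
  assume "PointSet_meet \<eta> balls Point (GBasicPointSet D) (GBasicPointSet F)"
  then obtain B C D' F' where D': "\<eta> D' balls" "\<eta> D' (pt D)" and F': "\<eta> F' (pt F)"
    and BC: "same_center \<eta> Point B C"
    and D'F': "same_center \<eta> Point B D'" "same_center \<eta> Point C F'"
    unfolding PointSet_meet_def GBasicPointSet_iff by blast
  have "same_center \<eta> Point D' F'"
    using BC D'F' by (simp add: same_center_def ext_eq_def)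
  then have "\<eta> D' (pt F') \<or> \<eta> F' (pt D')"
    using same_center_nested D'(1) by blast
  then have "\<exists>C. \<eta> C (pt D) \<and> \<eta> C (pt F)"
    using D' F' pt_trans by blast
  then show False
    using assms ext_iff by blast
qed

end

theorem theorem20:
  fixes \<eta> :: "'n \<Rightarrow> 'n \<Rightarrow> bool"
    and pt ext Concent Point GBasicPointSet :: "'n \<Rightarrow> 'n"
    and ED btw :: "'n \<Rightarrow> 'n \<Rightarrow> 'n"
    and balls P Q :: 'n
  assumes "point_geometry \<eta> pt ext balls Concent Point ED btw GBasicPointSet"
    and "\<eta> P balls" and "\<eta> Q balls"
    and "\<not> same_center \<eta> Point P Q"
  shows "\<exists>u v. GPointOpen \<eta> balls Point GBasicPointSet u \<and>
               GPointOpen \<eta> balls Point GBasicPointSet v \<and>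
               \<eta> P u \<and> \<eta> Q v \<and> \<not> PointSet_meet \<eta> balls Point u v"
proof -
  interpret point_geometry \<eta> pt ext balls Concent Point ED btw GBasicPointSet
    by (fact assms(1))
  obtain D F where D: "\<eta> D (Point P)" and F: "\<eta> F (Point Q)" and DF: "\<eta> D (ext F)"
    using external_concentric_balls assms(2-4) by blast
  have "\<eta> D balls" "\<eta> F balls"
    using D F Point_iff by blast+
  then show ?thesis
    using D F DF assms(2,3) basic_set_open Point_in_basic_set
      external_basic_sets_do_not_meet by blast
qed

end
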